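(* Let $n,N\ge 1$ be integers, let $S=\{r=(r_1,\dots,r_n)\in\mathbb{Z}^n : 1\le r_i\le N \text{ for } 1\le i\le n\}$ and $L=N^n$, and let $(\overline{a^N},\lambda_N)$ be the optimizer, i.e. $\overline{a^N}=(\overline{a^N_r})_{r\in S}\in\overline{\mathbb{R}_+^L}$, $\|\overline{a^N}\|_2=1$, and $$\sum_{r,s\in S,\ r\ne s}\frac{\overline{a^N_r}\,\overline{a^N_s}}{|r-s|^n}=\lambda_N .$$ Let $\Phi:S\to S$ be an isometric map, i.e. $|\Phi(r)-\Phi(s)|=|r-s|$ for all $r,s\in S$. Then $\overline{a^N_{\Phi(r)}}=\overline{a^N_r}$ for all $r\in S$.
   Context: $|\cdot|$ on $\mathbb{R}^n$ is the Euclidean norm; $\|a\|_2=(\sum_{r\in S} a_r^2)^{1/2}$. Vectors in $\mathbb{R}^L$ are indexed by the points of $S$, and $\overline{\mathbb{R}_+^L}$ is the set of vectors with nonnegative entries. The constant $\lambda_N$ is $$\lambda_N=\max_{\|a\|_2=\|b\|_2=1}\ \sum_{r,s\in S,\ r\neq s}\frac{a_r b_s}{|r-s|^n},$$ the maximum being over $a,b\in\mathbb{R}^L$. *)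

theory Defs
  imports "HOL-Analysis.Analysis"
begin

definition grid :: "nat \<Rightarrow> (real ^ 'n) set" where
  "grid N = {r. \<forall>i. r $ i \<in> \<int> \<and> 1 \<le> r $ i \<and> r $ i \<le> real N}"

text \<open>
  The dimension is \<open>CARD('n)\<close>. A vector indexed by the grid is a function
  \<open>real ^ 'n \<Rightarrow> real\<close> of which only the values on the grid are ever used;
  its Euclidean norm is \<^const>\<open>L2_set\<close> over the grid.
\<close>

definition riesz_form :: "nat \<Rightarrow> (real ^ 'n \<Rightarrow> real) \<Rightarrow> (real ^ 'n \<Rightarrow> real) \<Rightarrow> real" where
  "riesz_form N a b =
     (\<Sum>r\<in>grid N. \<Sum>s\<in>grid N - {r}. a r * b s / norm (r - s) ^ CARD('n))"

text \<open>
  The type argument only records the dimension; it cannot be inferred from \<open>N\<close>.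
  \<^const>\<open>Greatest\<close> denotes the maximum only if it is attained; see
  \<open>max_riesz_is_max\<close> below.
\<close>

definition max_riesz :: "'n::finite itself \<Rightarrow> nat \<Rightarrow> real" where
  "max_riesz TYPE('n) N =
     (GREATEST x. \<exists>a b :: real ^ 'n \<Rightarrow> real.
        L2_set a (grid N) = 1 \<and> L2_set b (grid N) = 1 \<and> x = riesz_form N a b)"

lemma finite_grid: "finite (grid N :: (real ^ 'n) set)"
proof -
  have "(grid N :: (real ^ 'n) set) \<subseteq> (\<lambda>f. \<chi> i. real (f i)) ` (UNIV \<rightarrow>\<^sub>E {..N})"
  proof
    fix r :: "real ^ 'n" assume r: "r \<in> grid N"
    have k: "\<exists>k. r $ i = real k \<and> k \<le> N" for i
    proof -
      have "r $ i \<in> \<int>" "1 \<le> r $ i" "r $ i \<le> real N" using r by (auto simp: grid_def)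
      then obtain z where z: "r $ i = of_int z" by (auto elim: Ints_cases)
      then have "0 \<le> z" "z \<le> int N" using \<open>1 \<le> r $ i\<close> \<open>r $ i \<le> real N\<close> by linarith+
      then show ?thesis using z by (intro exI[of _ "nat z"]) auto
    qed
    then obtain f where "\<And>i. r $ i = real (f i) \<and> f i \<le> N" by metis
    then show "r \<in> (\<lambda>f. \<chi> i. real (f i)) ` (UNIV \<rightarrow>\<^sub>E {..N})"
      by (intro image_eqI[of _ _ f]) (auto simp: vec_eq_iff)
  qed
  moreover have "finite (UNIV \<rightarrow>\<^sub>E {..N} :: ('n \<Rightarrow> nat) set)" by (intro finite_PiE) auto
  ultimately show ?thesis by (meson finite_imageI finite_subset)
qed

lemma max_riesz_is_max:
  fixes a b :: "real ^ 'n \<Rightarrow> real"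
  assumes "N \<ge> 1"
  shows "\<exists>a b :: real ^ 'n \<Rightarrow> real. L2_set a (grid N) = 1 \<and> L2_set b (grid N) = 1 \<and>
           riesz_form N a b = max_riesz TYPE('n) N" (is ?attained)
    and "L2_set a (grid N) = 1 \<Longrightarrow> L2_set b (grid N) = 1 \<Longrightarrow>
           riesz_form N a b \<le> max_riesz TYPE('n) N"
proof -
  let ?G = "grid N :: (real ^ 'n) set"
  define B :: "(real ^ 'n \<Rightarrow> real) set"
    where "B = PiE UNIV (\<lambda>r. if r \<in> ?G then {-1..1} else {0})"
  define K where "K = B \<inter> {a. (\<Sum>r\<in>?G. (a r)\<^sup>2) = 1}"
  have L2: "L2_set a ?G = 1 \<longleftrightarrow> (\<Sum>r\<in>?G. (a r)\<^sup>2) = 1" for a by (simp add: L2_set_def)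
  have "compactin (product_topology (\<lambda>_. euclidean) UNIV) B"
    unfolding B_def by (subst compactin_PiE) auto
  then have "compact B" by (simp add: euclidean_product_topology)
  moreover have "closed {a :: real ^ 'n \<Rightarrow> real. (\<Sum>r\<in>?G. (a r)\<^sup>2) = 1}"
    by (intro closed_Collect_eq continuous_intros continuous_on_product_coordinates)
  ultimately have "compact K" unfolding K_def by (rule compact_Int_closed)
  then have "compact (K \<times> K)" by (intro compact_Times)
  have "(\<chi> i. 1) \<in> ?G" using assms by (auto simp: grid_def)
  then have "(\<lambda>r. if r = (\<chi> i. 1) then 1 else 0) \<in> K"
    by (auto simp: K_def B_def if_distrib[of "\<lambda>x. x\<^sup>2"] sum.delta[OF finite_grid]
        cong: if_cong)
  then have "K \<times> K \<noteq> {}" by auto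
  have coord1: "continuous_on A (\<lambda>p. fst p r)" and coord2: "continuous_on A (\<lambda>p. snd p r)"
    for A :: "((real ^ 'n \<Rightarrow> real) \<times> (real ^ 'n \<Rightarrow> real)) set" and r
    by (rule continuous_on_product_then_coordinatewise, rule continuous_on_fst, rule continuous_on_id,
        rule continuous_on_product_then_coordinatewise, rule continuous_on_snd, rule continuous_on_id)
  have "continuous_on (K \<times> K) (\<lambda>p. riesz_form N (fst p) (snd p))"
    unfolding riesz_form_def by (intro continuous_intros coord1 coord2) auto
  then obtain p where p: "p \<in> K \<times> K"
    and pmax: "\<And>q. q \<in> K \<times> K \<Longrightarrow> riesz_form N (fst q) (snd q) \<le> riesz_form N (fst p) (snd p)"
    using continuous_attains_sup[OF \<open>compact (K \<times> K)\<close> \<open>K \<times> K \<noteq> {}\<close>] by blast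
  define trunc where "trunc a = (\<lambda>r. if r \<in> ?G then a r else 0 :: real)" for a
  have trunc_K: "trunc a \<in> K" if "L2_set a ?G = 1" for a
  proof -
    have "\<bar>a r\<bar> \<le> 1" if "r \<in> ?G" for r
      using member_le_L2_set[OF finite_grid that, of "\<lambda>r. \<bar>a r\<bar>"] \<open>L2_set a ?G = 1\<close>
      by (simp add: L2_set_def)
    then show ?thesis
      using that by (auto simp: K_def B_def trunc_def L2 abs_le_iff minus_le_iff)
  qed
  have trunc_form: "riesz_form N (trunc a) (trunc b) = riesz_form N a b" for a b
    by (simp add: riesz_form_def trunc_def)
  have ub: "riesz_form N a b \<le> riesz_form N (fst p) (snd p)"
    if "L2_set a ?G = 1" "L2_set b ?G = 1" for a b
    using pmax[of "(trunc a, trunc b)"] trunc_K that by (simp add: trunc_form)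
  have "L2_set (fst p) ?G = 1" "L2_set (snd p) ?G = 1" using p by (auto simp: K_def L2)
  moreover from this have eq: "max_riesz TYPE('n) N = riesz_form N (fst p) (snd p)"
    unfolding max_riesz_def by (intro Greatest_equality) (use ub in blast)+
  ultimately show ?attained by metis
  show "riesz_form N a b \<le> max_riesz TYPE('n) N"
    if "L2_set a (grid N) = 1" "L2_set b (grid N) = 1"
    using ub[OF that] eq by simp
qed

end

theory Submission
  imports Defs
begin

text \<open>
  Nonnegative optimizers are unique: if \<open>a\<close> and \<open>b\<close> are two of them, then by the
  parallelogram law \<open>w = a - b\<close> also satisfies \<open>Q w = \<lambda> \<parallel>w\<parallel>\<^sup>2\<close>, where \<open>Q\<close> is the quadratic
  form of the kernel. As \<open>Q \<bar>w\<bar> \<le> \<lambda> \<parallel>w\<parallel>\<^sup>2\<close> and the kernel is strictly positive off the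
  diagonal, \<open>w\<close> has constant sign, so \<open>a \<le> b\<close> or \<open>b \<le> a\<close> on the grid; equal norms force
  \<open>a = b\<close>. An isometric self-map permutes the finite grid, hence \<open>a \<circ> \<Phi>\<close> is again a
  nonnegative optimizer.
\<close>

lemma riesz_form_scale: "riesz_form N (\<lambda>r. c * a r) (\<lambda>r. d * b r) = c * d * riesz_form N a b"
  by (simp add: riesz_form_def sum_distrib_left mult.assoc mult.left_commute)

text \<open>Both sides are homogeneous of degree two, so a vector with nonzero norm may be rescaled
  to the unit sphere, where \<open>max_riesz\<close> is an upper bound. A vector of norm zero
  vanishes on the grid.\<close>

lemma riesz_form_le_max_riesz_mult:
  fixes v :: "real ^ 'n \<Rightarrow> real"
  assumes "N \<ge> 1"
  shows "riesz_form N v v \<le> max_riesz TYPE('n) N * (\<Sum>r\<in>grid N. (v r)\<^sup>2)"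
proof (cases "L2_set v (grid N) = 0")
  case True
  then have "\<And>r. r \<in> grid N \<Longrightarrow> v r = 0" by (simp add: L2_set_eq_0_iff[OF finite_grid])
  then show ?thesis by (simp add: riesz_form_def)
next
  case False
  define l where "l = L2_set v (grid N)"
  have l: "l > 0" using False by (simp add: l_def less_le)
  have l2: "l\<^sup>2 = (\<Sum>r\<in>grid N. (v r)\<^sup>2)" by (simp add: l_def L2_set_def sum_nonneg)
  have "L2_set (\<lambda>r. inverse l * v r) (grid N) = 1"
    using L2_set_right_distrib[of "inverse l" v "grid N"] l by (simp add: l_def)
  then have "riesz_form N (\<lambda>r. inverse l * v r) (\<lambda>r. inverse l * v r) \<le> max_riesz TYPE('n) N"
    by (intro max_riesz_is_max(2) assms)
  then have "riesz_form N v v / l\<^sup>2 \<le> max_riesz TYPE('n) N"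
    by (simp add: riesz_form_scale power2_eq_square divide_inverse mult.commute)
  then show ?thesis using l by (simp add: pos_divide_le_eq flip: l2)
qed

text \<open>The mixed products of \<open>a\<close> and \<open>b\<close> cancel within each
  summand.\<close>

lemma riesz_form_parallelogram:
  "riesz_form N (\<lambda>r. a r + b r) (\<lambda>r. a r + b r) + riesz_form N (\<lambda>r. a r - b r) (\<lambda>r. a r - b r)
     = 2 * riesz_form N a a + 2 * riesz_form N b b"
  unfolding riesz_form_def sum_distrib_left sum.distrib[symmetric]
  by (intro sum.cong refl) (simp add: algebra_simps add_divide_distrib diff_divide_distrib)

lemma riesz_form_less_abs:
  fixes w :: "real ^ 'n \<Rightarrow> real"
  assumes "r \<in> grid N" "s \<in> grid N" "w r * w s < 0"
  shows "riesz_form N w w < riesz_form N (\<lambda>r. \<bar>w r\<bar>) (\<lambda>r. \<bar>w r\<bar>)"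
proof -
  have le: "w p * w q / norm (p - q) ^ CARD('n) \<le> \<bar>w p\<bar> * \<bar>w q\<bar> / norm (p - q) ^ CARD('n)" for p q
    by (intro divide_right_mono) (simp_all add: abs_mult[symmetric])
  \<comment> \<open>A square is never negative, so the pair lies off the diagonal and its kernel
    value is positive.\<close>
  have "r \<noteq> s" using assms(3) by (auto simp: mult_less_0_iff)
  have "w r * w s < \<bar>w r\<bar> * \<bar>w s\<bar>" using assms(3) by (simp add: abs_mult[symmetric])
  then have less: "w r * w s / norm (r - s) ^ CARD('n) < \<bar>w r\<bar> * \<bar>w s\<bar> / norm (r - s) ^ CARD('n)"
    using \<open>r \<noteq> s\<close> by (intro divide_strict_right_mono) auto
  \<comment> \<open>The row of \<open>r\<close> increases strictly because of its entry at
    \<open>s\<close>; every other row increases weakly.\<close>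
  have "(\<Sum>q\<in>grid N - {r}. w r * w q / norm (r - q) ^ CARD('n))
      < (\<Sum>q\<in>grid N - {r}. \<bar>w r\<bar> * \<bar>w q\<bar> / norm (r - q) ^ CARD('n))"
    using assms(2) \<open>r \<noteq> s\<close> less le by (intro sum_strict_mono_ex1) (auto simp: finite_grid)
  then show ?thesis
    unfolding riesz_form_def using assms(1)
    by (intro sum_strict_mono_ex1 finite_grid ballI sum_mono le) auto
qed

text \<open>The differences of squares are nonnegative and sum to zero, so each of them
  vanishes.\<close>

lemma eq_of_le_of_sum_squares_eq:
  fixes a b :: "'a \<Rightarrow> real"
  assumes "finite A" "\<And>r. r \<in> A \<Longrightarrow> 0 \<le> a r" "\<And>r. r \<in> A \<Longrightarrow> a r \<le> b r"
    and "(\<Sum>r\<in>A. (a r)\<^sup>2) = (\<Sum>r\<in>A. (b r)\<^sup>2)" "r \<in> A"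
  shows "a r = b r"
proof -
  have "(\<Sum>r\<in>A. (b r)\<^sup>2 - (a r)\<^sup>2) = 0" using assms(4) by (simp add: sum_subtractf)
  then have "\<forall>r\<in>A. (b r)\<^sup>2 - (a r)\<^sup>2 = 0"
    using assms(1-3) by (subst (asm) sum_nonneg_eq_0_iff) (auto simp: power_mono)
  then have "(a r)\<^sup>2 = (b r)\<^sup>2" using assms(5) by simp
  moreover have "0 \<le> a r" "0 \<le> b r" using assms(2,3,5) by force+
  ultimately show ?thesis by (simp add: power2_eq_iff_nonneg)
qed

lemma nonneg_optimizer_unique:
  fixes a b :: "real ^ 'n \<Rightarrow> real"
  assumes "N \<ge> 1"
    and a: "\<And>r. r \<in> grid N \<Longrightarrow> a r \<ge> 0" "L2_set a (grid N) = 1"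
      "riesz_form N a a = max_riesz TYPE('n) N"
    and b: "\<And>r. r \<in> grid N \<Longrightarrow> b r \<ge> 0" "L2_set b (grid N) = 1"
      "riesz_form N b b = max_riesz TYPE('n) N"
    and "r \<in> grid N"
  shows "a r = b r"
proof -
  let ?G = "grid N :: (real ^ 'n) set" and ?m = "max_riesz TYPE('n) N"
  define w where "w = (\<lambda>r. a r - b r)"
  have sq: "(\<Sum>r\<in>?G. (a r)\<^sup>2) = 1" "(\<Sum>r\<in>?G. (b r)\<^sup>2) = 1"
    using a(2) b(2) by (simp_all add: L2_set_def)
  have "(\<Sum>r\<in>?G. (a r + b r)\<^sup>2) + (\<Sum>r\<in>?G. (w r)\<^sup>2) = (\<Sum>r\<in>?G. 2 * (a r)\<^sup>2 + 2 * (b r)\<^sup>2)"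
    unfolding sum.distrib[symmetric] w_def
    by (intro sum.cong refl) (simp add: power2_eq_square algebra_simps)
  also have "\<dots> = 4" by (simp add: sum.distrib sum_distrib_left[symmetric] sq)
  finally have "?m * (\<Sum>r\<in>?G. (a r + b r)\<^sup>2) + ?m * (\<Sum>r\<in>?G. (w r)\<^sup>2) = ?m * 4"
    by (simp add: distrib_left[symmetric])
  moreover have "riesz_form N (\<lambda>r. a r + b r) (\<lambda>r. a r + b r) + riesz_form N w w = ?m * 4"
    unfolding w_def riesz_form_parallelogram using a(3) b(3) by simp
  \<comment> \<open>The two identities have the same total \<open>?m * 4\<close>. Since
    \<open>a + b\<close> contributes at most its share of the form, \<open>w\<close> must contribute
    at least its own.\<close>
  ultimately have "?m * (\<Sum>r\<in>?G. (w r)\<^sup>2) \<le> riesz_form N w w"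
    using riesz_form_le_max_riesz_mult[OF assms(1), of "\<lambda>r. a r + b r"] by linarith
  moreover have "riesz_form N (\<lambda>r. \<bar>w r\<bar>) (\<lambda>r. \<bar>w r\<bar>) \<le> ?m * (\<Sum>r\<in>?G. (w r)\<^sup>2)"
    using riesz_form_le_max_riesz_mult[OF assms(1), of "\<lambda>r. \<bar>w r\<bar>"] by simp
  \<comment> \<open>Passing to \<bar>w\<bar> keeps the squares, so it cannot raise the form above
    the value already reached by \<open>w\<close>; opposite signs would raise it.\<close>
  ultimately have "\<not> w p * w q < 0" if "p \<in> ?G" "q \<in> ?G" for p q
    using riesz_form_less_abs[OF that, of w] by linarith
  \<comment> \<open>If both alternatives failed, a point with \<open>w\<close> positive and one with
    \<open>w\<close> negative would give a negative product.\<close>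
  then have "(\<forall>p\<in>?G. a p \<le> b p) \<or> (\<forall>p\<in>?G. b p \<le> a p)"
    unfolding w_def mult_less_0_iff by (meson diff_gt_0_iff_gt diff_less_0_iff_less not_le)
  then show ?thesis
    using eq_of_le_of_sum_squares_eq[of ?G a b r] eq_of_le_of_sum_squares_eq[of ?G b a r]
      a(1) b(1) sq \<open>r \<in> grid N\<close> by (auto simp: finite_grid)
qed

text \<open>Preserving distances gives injectivity, and an injective self-map of a finite set is
  onto.\<close>

lemma isometric_bij_betw:
  fixes \<Phi> :: "'a :: real_normed_vector \<Rightarrow> 'a"
  assumes "finite A" "\<Phi> \<in> A \<rightarrow> A"
    and "\<And>r s. r \<in> A \<Longrightarrow> s \<in> A \<Longrightarrow> norm (\<Phi> r - \<Phi> s) = norm (r - s)"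
  shows "bij_betw \<Phi> A A"
proof -
  have "inj_on \<Phi> A"
    by (intro inj_onI) (metis assms(3) norm_eq_zero right_minus_eq)
  moreover have "\<Phi> ` A \<subseteq> A" using assms(2) by blast
  ultimately show ?thesis
    using assms(1) by (simp add: bij_betw_def endo_inj_surj)
qed

text \<open>Both sums are reindexed along \<Phi>; the kernel depends only on distances.\<close>

lemma riesz_form_compose_isometric:
  fixes \<Phi> :: "real ^ 'n \<Rightarrow> real ^ 'n"
  assumes bij: "bij_betw \<Phi> (grid N) (grid N)"
    and iso: "\<And>r s. r \<in> grid N \<Longrightarrow> s \<in> grid N \<Longrightarrow> norm (\<Phi> r - \<Phi> s) = norm (r - s)"
  shows "riesz_form N (\<lambda>r. a (\<Phi> r)) (\<lambda>r. b (\<Phi> r)) = riesz_form N a b"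
proof -
  have "(\<Sum>s\<in>grid N - {\<Phi> r}. a (\<Phi> r) * b s / norm (\<Phi> r - s) ^ CARD('n))
      = (\<Sum>s\<in>grid N - {r}. a (\<Phi> r) * b (\<Phi> s) / norm (r - s) ^ CARD('n))"
    if r: "r \<in> grid N" for r
  proof -
    \<comment> \<open>The excluded diagonal point moves along with \<Phi>.\<close>
    have "bij_betw \<Phi> (grid N - {r}) (grid N - {\<Phi> r})"
      using bij_betw_DiffI[OF bij, of "{r}" "{\<Phi> r}"] r bij_betwE[OF bij] by auto
    from sum.reindex_bij_betw[OF this, of "\<lambda>s. a (\<Phi> r) * b s / norm (\<Phi> r - s) ^ CARD('n)"]
    show ?thesis using iso r by simp
  qed
  then show ?thesis
    unfolding riesz_form_def
    by (subst sum.reindex_bij_betw[OF bij, symmetric]) simp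
qed

theorem theorem3:
  fixes N :: nat
    and a :: "real ^ 'n \<Rightarrow> real"
    and \<Phi> :: "real ^ 'n \<Rightarrow> real ^ 'n"
  assumes "N \<ge> 1"
    and "\<And>r. r \<in> grid N \<Longrightarrow> a r \<ge> 0"
    and "L2_set a (grid N) = 1"
    and "riesz_form N a a = max_riesz TYPE('n) N"
    and "\<Phi> \<in> grid N \<rightarrow> grid N"
    and "\<And>r s. r \<in> grid N \<Longrightarrow> s \<in> grid N \<Longrightarrow> norm (\<Phi> r - \<Phi> s) = norm (r - s)"
  shows "\<forall>r\<in>grid N. a (\<Phi> r) = a r"
proof
  fix r :: "real ^ 'n" assume "r \<in> grid N"
  have bij: "bij_betw \<Phi> (grid N) (grid N)"
    using finite_grid assms(5,6) by (rule isometric_bij_betw)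
  have "L2_set (\<lambda>r. a (\<Phi> r)) (grid N) = 1"
    using assms(3) sum.reindex_bij_betw[OF bij, of "\<lambda>r. (a r)\<^sup>2"] by (simp add: L2_set_def)
  moreover have "riesz_form N (\<lambda>r. a (\<Phi> r)) (\<lambda>r. a (\<Phi> r)) = max_riesz TYPE('n) N"
    using riesz_form_compose_isometric[OF bij assms(6)] assms(4) by simp
  moreover have "\<And>r. r \<in> grid N \<Longrightarrow> a (\<Phi> r) \<ge> 0" using assms(2,5) by blast
  ultimately show "a (\<Phi> r) = a r"
    using nonneg_optimizer_unique[of N "\<lambda>r. a (\<Phi> r)" a r] assms(1-4) \<open>r \<in> grid N\<close> by blast
qed

end
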